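(* Let $R$ be a finite commutative ring with identity and let $k\in\mathbb{N}$. If $\gcd(k,|R|)=1$, then $$\big(G_R(k)\big)_{red}\simeq G_{R_{red}}(k).$$
   Context: For a commutative ring $R$ with identity and a positive integer $k$, $R^*$ is the group of units and $U_{R,k}=\{x^k:x\in R^*\}$. For an abelian group $A$ and $S\subseteq A$ with $0\notin S$, $X(A,S)$ denotes the Cayley digraph with vertex set $A$ and an arc from $v$ to $w$ iff $w-v\in S$; it is undirected if $S=-S$ and directed otherwise. Define $G_R(k)=X(R,U_{R,k})$. $R_{red}=R/\mathcal{N}_R$, where $\mathcal{N}_R$ is the nilradical of $R$. Reduced graph: for a graph $\Gamma$, directed or undirected, define $a\equiv b$ iff $N(a)=N(b)$, where $N(a)=\{v: av \text{ is an edge}\}$ in the undirected case and $N(a)=\{v:\text{there is an arc from }a\text{ to }v\text{ or from }v\text{ to }a\}$ in the directed case; $\Gamma_{red}$ is the graph whose vertices are the equivalence classes $[a]$, with $[a]$ adjacent to $[b]$ iff $a$ is adjacent to $b$ in $\Gamma$ (with the corresponding orientation in the directed case). $\simeq$ denotes (di)graph isomorphism. *)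

theory Defs
  imports
    "HOL-Algebra.QuotRing"
    "Graph_Theory.Pair_Digraph"
    "Graph_Theory.Digraph_Isomorphism"
begin

text \<open>
  All graphs are digraphs without parallel arcs; an undirected graph is a symmetric digraph
  (an edge being a pair of opposite arcs), as in the underlying graph library.
\<close>

text \<open>
  The group is written multiplicatively, so the difference \<open>w - v\<close> appears as
  \<open>w \<otimes> inv v\<close>. The definition is meant for an abelian group and a connection set without
  the neutral element (with the neutral element in \<open>S\<close> there is a loop at every vertex).
\<close>

definition cayley_digraph :: "('a, 'b) monoid_scheme \<Rightarrow> 'a set \<Rightarrow> 'a pair_pre_digraph" where
  "cayley_digraph A S =
     \<lparr> pverts = carrier A,
       parcs = {(v, w). v \<in> carrier A \<and> w \<in> carrier A \<and> w \<otimes>\<^bsub>A\<^esub> inv\<^bsub>A\<^esub> v \<in> S} \<rparr>"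

definition unit_powers :: "('a, 'b) ring_scheme \<Rightarrow> nat \<Rightarrow> 'a set" where
  "unit_powers R k = {x [^]\<^bsub>R\<^esub> k | x. x \<in> Units R}"

definition unitary_cayley :: "('a, 'b) ring_scheme \<Rightarrow> nat \<Rightarrow> 'a pair_pre_digraph" where
  "unitary_cayley R k = cayley_digraph (add_monoid R) (unit_powers R k)"

definition nilradical :: "('a, 'b) ring_scheme \<Rightarrow> 'a set" where
  "nilradical R = {x \<in> carrier R. \<exists>n::nat. n > 0 \<and> x [^]\<^bsub>R\<^esub> n = \<zero>\<^bsub>R\<^esub>}"

definition reduced_ring :: "('a, 'b) ring_scheme \<Rightarrow> 'a set ring" where
  "reduced_ring R = R Quot (nilradical R)"

definition nbrs :: "'a pair_pre_digraph \<Rightarrow> 'a \<Rightarrow> 'a set" where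
  "nbrs G a =
     (if symmetric G then {v \<in> pverts G. (a, v) \<in> parcs G}
      else {v \<in> pverts G. (a, v) \<in> parcs G \<or> (v, a) \<in> parcs G})"

definition nbr_class :: "'a pair_pre_digraph \<Rightarrow> 'a \<Rightarrow> 'a set" where
  "nbr_class G a = {b \<in> pverts G. nbrs G a = nbrs G b}"

definition reduced_graph :: "'a pair_pre_digraph \<Rightarrow> 'a set pair_pre_digraph" where
  "reduced_graph G =
     \<lparr> pverts = nbr_class G ` pverts G,
       parcs = {(nbr_class G a, nbr_class G b) | a b. (a, b) \<in> parcs G} \<rparr>"

text \<open>
  Adjacency of classes in the reduced graph is prescribed by ``\<open>[a]\<close> is adjacent to \<open>[b]\<close> iff
  \<open>a\<close> is adjacent to \<open>b\<close>''. This presupposes independence of the representatives, which can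
  fail for a directed graph: in the path \<open>a\<close> to \<open>b\<close> to \<open>c\<close> the vertices \<open>a\<close> and \<open>c\<close> are
  identified. The following predicate expresses that the prescription is met by
  \<^const>\<open>reduced_graph\<close>.
\<close>

definition reduced_graph_well_defined :: "'a pair_pre_digraph \<Rightarrow> bool" where
  "reduced_graph_well_defined G \<longleftrightarrow>
     (\<forall>a\<in>pverts G. \<forall>b\<in>pverts G.
        (nbr_class G a, nbr_class G b) \<in> parcs (reduced_graph G) \<longleftrightarrow> (a, b) \<in> parcs G)"

end

theory Submission
  imports Defs "HOL-Algebra.Multiplicative_Group" "HOL-Algebra.Divisibility"
begin

text \<open>
  Write \<open>N\<close> for the nilradical, \<open>U\<close> for the group of \<open>k\<close>-th powers of units and \<open>T = U \<union> -U\<close>.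
  The theorem holds because \<open>a\<close> and \<open>b\<close> have the same neighbours exactly when \<open>a - b \<in> N\<close>: the
  classes of the reduced graph are then literally the elements of \<open>R / N\<close>, and the two graphs
  are not only isomorphic but equal (\<open>reduced_graph_unitary_cayley\<close>).

  Elements congruent modulo \<open>N\<close> have the same neighbours because \<open>U + N = U\<close>
  (\<open>unit_powers_closed_add_nilpotent\<close>). This is the place where \<open>k\<close> must be coprime to \<open>|R|\<close>:
  \<open>x\<^sup>k + n = x\<^sup>k (1 + n')\<close> with \<open>n'\<close> nilpotent, and \<open>1 + N\<close> is a subgroup of the units whose
  order \<open>|N|\<close> divides \<open>|R|\<close>, so that each of its elements is a \<open>k\<close>-th power. The same fact, together
  with the lifting of units along \<open>R \<rightarrow> R / N\<close>, shows that \<open>U\<close> is the full preimage of the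
  corresponding set for \<open>R / N\<close> (\<open>coset_mem_unit_powers_iff\<close>). Arcs therefore depend only on
  the cosets of their ends, and this also makes the reduced graph well defined.

  Conversely the neighbourhood of \<open>a\<close> is \<open>a + T\<close>, whether the graph is directed or not, so equal
  neighbourhoods of \<open>a\<close> and \<open>b\<close> give \<open>T + c = T\<close> for \<open>c = a - b\<close>. If \<open>c\<close> were not nilpotent, it
  would be nonzero in a residue field \<open>F\<close> with \<open>q\<close> elements. Let \<open>H\<close> be the image of \<open>T\<close>, a
  subgroup of the units of \<open>F\<close> with \<open>H + c = H\<close>. Summing the elements of \<open>H\<close> yields
  \<open>|H| c = 0\<close>; but \<open>|H|\<close> divides \<open>q - 1\<close> and \<open>q c = 0\<close>, whence \<open>c = 0\<close>
  (\<open>units_subgroup_translation_trivial\<close>, \<open>units_subgroup_translation_nilpotent\<close>).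

  All facts about \<open>N\<close> rest on its description as the intersection of the maximal ideals
  (\<open>nilradical_eq_Inter_maximalideals\<close>). For a finite ring this is elementary, because every element
  has an idempotent power, and a nonzero idempotent is avoided by some maximal ideal.
\<close>

section \<open>Monoids, unit groups and quotient rings\<close>

lemma (in monoid) finite_imp_idempotent_power:
  assumes fin: "finite (carrier G)" and x: "x \<in> carrier G"
  obtains m :: nat where "m > 0" "x [^] m \<otimes> x [^] m = x [^] m"
proof -
  have "\<not> inj (\<lambda>n::nat. x [^] n)"
    using fin x by (meson finite_subset finite_imageD image_subsetI infinite_UNIV_nat nat_pow_closed)
  then obtain i j :: nat where ij: "i < j" "x [^] i = x [^] j"
    by (metis injI linorder_neqE_nat)
  \<comment> \<open>From exponent \<open>i\<close> on, the powers of \<open>x\<close> are periodic with period \<open>p\<close>;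
    a positive multiple of \<open>p\<close> beyond \<open>i\<close> then serves as \<open>m\<close>.\<close>
  define p where "p = j - i"
  have p: "p > 0" "x [^] (i + p) = x [^] i"
    using ij by (auto simp: p_def)
  have step: "x [^] (n + p) = x [^] n" if "i \<le> n" for n
  proof -
    have "x [^] (n + p) = x [^] (i + p) \<otimes> x [^] (n - i)"
      using that x by (simp add: nat_pow_mult add.commute)
    also have "\<dots> = x [^] n"
      using that x p(2) by (simp add: nat_pow_mult)
    finally show ?thesis .
  qed
  have steps: "x [^] (n + t * p) = x [^] n" if "i \<le> n" for n t
    using that by (induction t) (simp_all add: step add.assoc[symmetric] add.commute[of p])
  have "i \<le> Suc i * p"
    using p(1) by (cases p) auto
  then have "x [^] (Suc i * p) \<otimes> x [^] (Suc i * p) = x [^] (Suc i * p)"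
    using steps x by (simp only: nat_pow_mult)
  with p(1) show thesis
    by (intro that[of "Suc i * p"]) auto
qed

lemma (in cring) Units_a_inv_closed:
  assumes u: "u \<in> Units R"
  shows "\<ominus> u \<in> Units R"
proof -
  have "(\<ominus> u) \<otimes> (\<ominus> (inv u)) \<in> Units R"
    using u by (simp add: l_minus r_minus Units_closed)
  then show ?thesis
    by (rule unit_factor) (use u in \<open>simp_all add: Units_closed\<close>)
qed

lemma (in ring_hom_ring) hom_Units:
  assumes u: "u \<in> Units R"
  shows "h u \<in> Units S"
proof -
  have inv: "inv u \<in> carrier R" "inv u \<otimes> u = \<one>" "u \<otimes> inv u = \<one>"
    using u by simp_all
  have "h (inv u) \<otimes>\<^bsub>S\<^esub> h u = \<one>\<^bsub>S\<^esub>" "h u \<otimes>\<^bsub>S\<^esub> h (inv u) = \<one>\<^bsub>S\<^esub>"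
    using hom_mult[of "inv u" u] hom_mult[of u "inv u"] u inv hom_one by (simp_all add: R.Units_closed)
  with u inv(1) show ?thesis
    unfolding Units_def[of S] by (auto intro: R.Units_closed)
qed

lemma zero_FactRing: "\<zero>\<^bsub>R Quot I\<^esub> = I"
  by (simp add: FactRing_def)

lemma carrier_FactRing: "carrier (R Quot I) = (+>\<^bsub>R\<^esub>) I ` carrier R"
  unfolding FactRing_def A_RCOSETS_def' by auto

lemma (in primeideal) pow_memD:
  assumes x: "x \<in> carrier R" "x [^] (n::nat) \<in> I"
  shows "x \<in> I"
proof -
  have "\<one> \<notin> I"
    using one_imp_carrier I_notcarr by auto
  then show ?thesis
    using x
  proof (induction n)
    case (Suc n)
    then show ?case
      using I_prime[of "x [^] n" x] by auto
  qed simp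
qed

section \<open>The nilradical of a finite commutative ring\<close>

locale finite_cring = cring R for R (structure) +
  assumes finite_carrier: "finite (carrier R)"
begin

text \<open>
  Among the finitely many ideals avoiding \<open>e\<close> take a maximal one, \<open>I\<close>. The ideal
  \<open>K = {x. e x \<in> I}\<close> contains \<open>I\<close> and still avoids \<open>e = e\<^sup>2\<close>, hence equals \<open>I\<close>; since
  \<open>e (1 - e) = 0\<close>, it follows that \<open>1 - e \<in> I\<close>. A larger ideal contains \<open>e\<close> as well and so is
  the whole ring.
\<close>

lemma idempotent_avoided_by_maximalideal:
  assumes e: "e \<in> carrier R" "e \<otimes> e = e" "e \<noteq> \<zero>"
  obtains M where "maximalideal M R" "e \<notin> M"
proof -
  define S where "S = {I. ideal I R \<and> e \<notin> I}"
  have "S \<subseteq> Pow (carrier R)"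
    by (auto simp: S_def dest: ideal.Icarr)
  then have finS: "finite S"
    using finite_carrier by (simp add: finite_subset)
  have "{\<zero>} \<in> S"
    using zeroideal e(3) by (simp add: S_def)
  then obtain I where I: "I \<in> S" "\<And>J. J \<in> S \<Longrightarrow> I \<subseteq> J \<Longrightarrow> J = I"
    using finite_has_maximal[OF finS] by blast
  interpret I: ideal I R
    using I(1) by (simp add: S_def)
  define K where "K = {x \<in> carrier R. e \<otimes> x \<in> I}"
  have "ideal K R"
  proof (rule idealI[OF ring_axioms])
    show "subgroup K (add_monoid R)"
    proof (rule add.subgroupI)
      show "K \<subseteq> carrier R" "K \<noteq> {}"
        using e I.zero_closed by (auto simp: K_def intro!: exI[of _ \<zero>])
      show "\<ominus> a \<in> K" if "a \<in> K" for a
        using that e by (simp add: K_def r_minus)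
      show "a \<oplus> b \<in> K" if "a \<in> K" "b \<in> K" for a b
        using that e by (simp add: K_def r_distr)
    qed
  next
    fix a x assume ax: "a \<in> K" "x \<in> carrier R"
    then have "e \<otimes> a \<otimes> x \<in> I"
      by (simp add: K_def I.I_r_closed)
    with ax e show "x \<otimes> a \<in> K" "a \<otimes> x \<in> K"
      by (simp_all add: K_def m_assoc m_comm[of x])
  qed
  moreover have "e \<notin> K"
    using I(1) e by (simp add: K_def S_def)
  moreover have "I \<subseteq> K"
    using e by (auto simp: K_def I.I_l_closed)
  ultimately have "K = I"
    by (intro I(2)) (auto simp: S_def)
  moreover have "\<one> \<ominus> e \<in> K"
    using e by (simp add: K_def a_minus_def r_distr r_minus r_neg)
  ultimately have co: "\<one> \<ominus> e \<in> I"
    by simp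
  have "maximalideal I R"
  proof (rule maximalidealI[OF I.is_ideal])
    show "carrier R \<noteq> I"
      using I(1) e by (auto simp: S_def)
  next
    fix J assume J: "ideal J R" "I \<subseteq> J" "J \<subseteq> carrier R"
    interpret J: ideal J R by fact
    show "J = I \<or> J = carrier R"
    proof (cases "e \<in> J")
      case True
      with co J(2) have "(\<one> \<ominus> e) \<oplus> e \<in> J"
        by (auto intro: J.a_closed)
      moreover have "(\<one> \<ominus> e) \<oplus> e = \<one>"
        using e by algebra
      ultimately show ?thesis
        using J.one_imp_carrier by simp
    qed (use J I(2) in \<open>auto simp: S_def\<close>)
  qed
  then show thesis
    using that I(1) by (simp add: S_def)
qed

text \<open>
  Maximal ideals are prime and so contain every nilpotent element. Conversely, an element of all
  of them has an idempotent power in all of them, and the only such idempotent is \<open>0\<close>.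
\<close>

lemma nilradical_eq_Inter_maximalideals:
  "nilradical R = {x \<in> carrier R. \<forall>M. maximalideal M R \<longrightarrow> x \<in> M}"
proof (intro equalityI subsetI)
  fix x assume x: "x \<in> nilradical R"
  then obtain n :: nat where n: "x \<in> carrier R" "x [^] n = \<zero>"
    by (auto simp: nilradical_def)
  have "x \<in> M" if "maximalideal M R" for M
  proof (rule primeideal.pow_memD[OF maximalideal_prime[OF that] n(1)])
    show "x [^] n \<in> M"
      using that n(2) by (simp add: additive_subgroup.zero_closed ideal.axioms(1) maximalideal.axioms(1))
  qed
  with n show "x \<in> {x \<in> carrier R. \<forall>M. maximalideal M R \<longrightarrow> x \<in> M}"
    by auto
next
  fix x assume "x \<in> {x \<in> carrier R. \<forall>M. maximalideal M R \<longrightarrow> x \<in> M}"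
  then have x: "x \<in> carrier R" and xM: "\<And>M. maximalideal M R \<Longrightarrow> x \<in> M"
    by simp_all
  obtain m :: nat where m: "m > 0" "x [^] m \<otimes> x [^] m = x [^] m"
    using finite_imp_idempotent_power[OF finite_carrier x] .
  have "x [^] m = \<zero>"
  proof (rule ccontr)
    assume "x [^] m \<noteq> \<zero>"
    then obtain M where M: "maximalideal M R" "x [^] m \<notin> M"
      using idempotent_avoided_by_maximalideal[OF nat_pow_closed[OF x] m(2)] by metis
    have "x [^] (m - 1) \<otimes> x \<in> M"
      using maximalideal.axioms(1)[OF M(1)] xM[OF M(1)] nat_pow_closed[OF x] by (rule ideal.I_l_closed)
    with m(1) M(2) show False
      using nat_pow_Suc[of x "m - 1"] by simp
  qed
  with m(1) x show "x \<in> nilradical R"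
    unfolding nilradical_def by blast
qed

text \<open>
  As an intersection of ideals the nilradical inherits closure under addition, with no recourse
  to the binomial theorem.
\<close>

lemma nilradical_ideal: "ideal (nilradical R) R"
proof (rule idealI[OF ring_axioms])
  have ideal: "ideal M R" and add: "additive_subgroup M R" if "maximalideal M R" for M
    using maximalideal.axioms(1)[OF that] by (auto dest: ideal.axioms(1))
  note N = nilradical_eq_Inter_maximalideals
  show "subgroup (nilradical R) (add_monoid R)"
  proof (rule add.subgroupI)
    show "nilradical R \<subseteq> carrier R" "nilradical R \<noteq> {}"
      using additive_subgroup.zero_closed[OF add] by (auto simp: N)
    show "\<ominus> a \<in> nilradical R" if "a \<in> nilradical R" for a
      using that additive_subgroup.a_inv_closed[OF add] by (simp add: N)
    show "a \<oplus> b \<in> nilradical R" if "a \<in> nilradical R" "b \<in> nilradical R" for a b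
      using that additive_subgroup.a_closed[OF add] by (simp add: N)
  qed
  fix a x assume "a \<in> nilradical R" "x \<in> carrier R"
  then show "x \<otimes> a \<in> nilradical R" "a \<otimes> x \<in> nilradical R"
    using ideal.I_l_closed[OF ideal] ideal.I_r_closed[OF ideal] by (simp_all add: N)
qed

text \<open>
  If the idempotent power \<open>e\<close> of \<open>x\<close> were \<open>1\<close>, then \<open>x\<close> would be a unit. Otherwise \<open>1 - e\<close> is a
  nonzero idempotent; a maximal ideal that avoids it contains \<open>e\<close>, because \<open>e (1 - e) = 0\<close>, and
  therefore contains \<open>x\<close>.
\<close>

lemma nonunit_mem_maximalideal:
  assumes x: "x \<in> carrier R" "x \<notin> Units R"
  obtains M where "maximalideal M R" "x \<in> M"
proof -
  obtain m :: nat where m: "m > 0" "x [^] m \<otimes> x [^] m = x [^] m"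
    using finite_imp_idempotent_power[OF finite_carrier x(1)] by blast
  define e where "e = x [^] m"
  have e: "e \<in> carrier R" "e \<otimes> e = e"
    using x(1) m(2) by (simp_all add: e_def)
  have "e \<noteq> \<one>"
  proof
    assume "e = \<one>"
    then have "x \<otimes> x [^] (m - 1) = \<one>"
      using m(1) x(1) nat_pow_Suc[of x "m - 1"] by (simp add: e_def m_comm)
    then show False
      using unit_factor[of x "x [^] (m - 1)"] x by simp
  qed
  have "(\<one> \<ominus> e) \<otimes> (\<one> \<ominus> e) = \<one> \<ominus> e \<ominus> e \<oplus> e \<otimes> e"
    using e(1) by algebra
  then have "(\<one> \<ominus> e) \<otimes> (\<one> \<ominus> e) = \<one> \<ominus> e"
    unfolding e(2) using e(1) by algebra
  moreover have "\<one> \<ominus> e \<noteq> \<zero>"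
    using \<open>e \<noteq> \<one>\<close> e(1) by simp
  ultimately obtain M where M: "maximalideal M R" "\<one> \<ominus> e \<notin> M"
    using e(1) idempotent_avoided_by_maximalideal[of "\<one> \<ominus> e"] by auto
  interpret M: primeideal M R
    using M(1) by (rule maximalideal_prime)
  have "e \<otimes> (\<one> \<ominus> e) = e \<ominus> e \<otimes> e"
    using e(1) by algebra
  then have "e \<otimes> (\<one> \<ominus> e) = \<zero>"
    using e by simp
  then have "e \<otimes> (\<one> \<ominus> e) \<in> M"
    by simp
  with M(2) e(1) have "e \<in> M"
    using M.I_prime by blast
  then have "x \<in> M"
    using M.pow_memD[OF x(1)] by (simp add: e_def)
  with M(1) show thesis
    by (rule that)
qed

text \<open>
  A maximal ideal containing \<open>u + n\<close> would contain the nilpotent \<open>n\<close>, hence also the unit \<open>u\<close>.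
\<close>

lemma Units_add_nilpotent:
  assumes u: "u \<in> Units R" and n: "n \<in> nilradical R"
  shows "u \<oplus> n \<in> Units R"
proof (rule ccontr)
  assume "u \<oplus> n \<notin> Units R"
  moreover have nR: "n \<in> carrier R"
    using n by (simp add: nilradical_def)
  ultimately obtain M where M: "maximalideal M R" "u \<oplus> n \<in> M"
    using u by (meson Units_closed a_closed nonunit_mem_maximalideal)
  interpret M: maximalideal M R by fact
  have "n \<in> M"
    using n M(1) by (simp add: nilradical_eq_Inter_maximalideals)
  with M(2) have "(u \<oplus> n) \<oplus> \<ominus> n \<in> M"
    by (intro M.a_closed[of "u \<oplus> n"]) auto
  moreover have "(u \<oplus> n) \<oplus> \<ominus> n = u"
    using u nR by (simp add: a_assoc r_neg Units_closed)
  ultimately have "u \<in> M"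
    by metis
  then have "inv u \<otimes> u \<in> M"
    using u by (intro M.I_l_closed) auto
  then show False
    using u M.one_imp_carrier M.I_notcarr by auto
qed

section \<open>Powers of units absorb nilpotent elements\<close>

lemma one_plus_nilradical_subgroup:
  "subgroup ((\<lambda>n. \<one> \<oplus> n) ` nilradical R) (units_of R)"
proof -
  interpret N: ideal "nilradical R" R by (rule nilradical_ideal)
  interpret U: group "units_of R" by (rule units_group)
  show ?thesis
  proof (rule U.subgroupI)
    show "(\<lambda>n. \<one> \<oplus> n) ` nilradical R \<subseteq> carrier (units_of R)"
      by (auto simp: units_of_carrier intro: Units_add_nilpotent)
    show "(\<lambda>n. \<one> \<oplus> n) ` nilradical R \<noteq> {}"
      using N.zero_closed by blast
  next
    fix a assume "a \<in> (\<lambda>n. \<one> \<oplus> n) ` nilradical R"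
    then obtain n where n: "n \<in> nilradical R" "a = \<one> \<oplus> n"
      by blast
    then have a: "a \<in> Units R"
      by (auto intro: Units_add_nilpotent)
    \<comment> \<open>From \<open>1 = inv a * (1 + n)\<close> one reads off \<open>inv a = 1 - inv a * n\<close>.\<close>
    have "inv a \<otimes> (\<one> \<oplus> n) = \<one>"
      using a n by auto
    then have "inv a = \<one> \<oplus> \<ominus> (inv a \<otimes> n)"
      using a n(1) N.Icarr by (simp add: r_distr) (metis N.Icarr Units_inv_closed a_assoc a_inv_closed m_closed r_neg r_zero)
    then show "inv\<^bsub>units_of R\<^esub> a \<in> (\<lambda>n. \<one> \<oplus> n) ` nilradical R"
      using a n(1) by (auto simp: units_of_inv intro!: image_eqI[of _ _ "\<ominus> (inv a \<otimes> n)"] N.I_l_closed)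
  next
    fix a b assume "a \<in> (\<lambda>n. \<one> \<oplus> n) ` nilradical R" "b \<in> (\<lambda>n. \<one> \<oplus> n) ` nilradical R"
    then obtain n m where n: "n \<in> nilradical R" "a = \<one> \<oplus> n" and m: "m \<in> nilradical R" "b = \<one> \<oplus> m"
      by blast
    have "a \<otimes> b = \<one> \<oplus> (n \<oplus> m \<oplus> n \<otimes> m)"
      using n(1)[THEN N.Icarr] m(1)[THEN N.Icarr] unfolding n m by algebra
    moreover have "n \<oplus> m \<oplus> n \<otimes> m \<in> nilradical R"
      using n m N.Icarr by (intro N.a_closed N.I_l_closed) auto
    ultimately show "a \<otimes>\<^bsub>units_of R\<^esub> b \<in> (\<lambda>n. \<one> \<oplus> n) ` nilradical R"
      by (simp add: units_of_mult)
  qed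
qed

text \<open>
  The group \<open>1 + N\<close> has order \<open>s = |N|\<close>, a divisor of \<open>|R|\<close> and hence coprime to \<open>k\<close>. A Bezout
  relation \<open>k i = s j + 1\<close> makes the \<open>i\<close>-th power of \<open>1 + n\<close> a \<open>k\<close>-th root of \<open>1 + n\<close>.
\<close>

lemma one_plus_nilpotent_is_power:
  fixes k :: nat
  assumes k: "k > 0" "coprime k (card (carrier R))" and n: "n \<in> nilradical R"
  obtains y where "y \<in> Units R" "y [^] k = \<one> \<oplus> n"
proof -
  let ?H = "(\<lambda>n. \<one> \<oplus> n) ` nilradical R"
  define s where "s = card (nilradical R)"
  define z where "z = \<one> \<oplus> n"
  interpret N: ideal "nilradical R" R by (rule nilradical_ideal)
  interpret U: group "units_of R" by (rule units_group)
  interpret H: group "(units_of R)\<lparr>carrier := ?H\<rparr>"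
    by (rule U.subgroup_imp_group[OF one_plus_nilradical_subgroup])
  have z: "z \<in> Units R" "z \<in> ?H"
    using n by (auto simp: z_def intro: Units_add_nilpotent)
  have "card ?H = s"
    unfolding s_def by (rule card_image) (auto simp: inj_on_def N.Icarr)
  then have "z [^]\<^bsub>(units_of R)\<lparr>carrier := ?H\<rparr>\<^esub> s = \<one>"
    using H.pow_order_eq_1[of z] z by (simp add: order_def units_of_one)
  then have zs: "z [^] s = \<one>"
    using z by (simp add: units_of_pow U.nat_pow_consistent[symmetric])
  have "s dvd card (carrier R)"
    using a_lagrange[OF finite_carrier N.is_additive_subgroup] unfolding s_def order_def
    by (metis dvd_triv_right)
  with k(2) have "coprime k s"
    by (metis coprime_divisors dvd_refl)
  then obtain i j where ij: "k * i = s * j + 1"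
    using k(1) bezout_nat[of k s] by auto
  have "(z [^] i) [^] k = z [^] (s * j + 1)"
    using z(1) by (simp only: nat_pow_pow ij[symmetric] mult.commute[of i] Units_closed)
  also have "\<dots> = (z [^] s) [^] j \<otimes> z"
    using z(1) by (simp add: nat_pow_pow Units_closed)
  finally have "(z [^] i) [^] k = \<one> \<oplus> n"
    using z(1) zs by (simp add: Units_closed z_def)
  then show thesis
    using z(1) by (intro that[of "z [^] i"] Units_pow_closed)
qed

text \<open>
  With \<open>u = x\<^sup>k\<close> one has \<open>u + n = u (1 + n / u)\<close>, and both factors are \<open>k\<close>-th powers of units.
\<close>

lemma unit_powers_closed_add_nilpotent:
  fixes k :: nat
  assumes k: "k > 0" "coprime k (card (carrier R))"
    and u: "u \<in> unit_powers R k" and n: "n \<in> nilradical R"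
  shows "u \<oplus> n \<in> unit_powers R k"
proof -
  interpret N: ideal "nilradical R" R by (rule nilradical_ideal)
  obtain x where x: "x \<in> Units R" "u = x [^] k"
    using u by (auto simp: unit_powers_def)
  then have uU: "u \<in> Units R"
    by (simp add: Units_pow_closed)
  have "inv u \<otimes> n \<in> nilradical R"
    using uU n by (intro N.I_l_closed) auto
  then obtain y where y: "y \<in> Units R" "y [^] k = \<one> \<oplus> inv u \<otimes> n"
    using one_plus_nilpotent_is_power[OF k] by blast
  have "u \<oplus> n = u \<otimes> (\<one> \<oplus> inv u \<otimes> n)"
    using uU N.Icarr[OF n] by (simp add: r_distr Units_closed m_assoc[symmetric])
  also have "\<dots> = (x \<otimes> y) [^] k"
    using x y by (simp add: nat_pow_distrib Units_closed)
  finally show ?thesis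
    using x y by (auto simp: unit_powers_def)
qed

end

section \<open>Translation symmetries of groups of units\<close>

text \<open>
  Translation by \<open>c\<close> permutes \<open>H\<close>, so comparing the sums of the elements before and after gives
  \<open>|H| c = 0\<close>. Since \<open>|R| = |H| d + 1\<close> for some \<open>d\<close>, by Lagrange for the units,
  and \<open>|R| c = 0\<close>, by Lagrange for the additive group, also \<open>c = 0\<close>.
\<close>

lemma (in field) units_subgroup_translation_trivial:
  assumes fin: "finite (carrier R)" and H: "subgroup H (units_of R)"
    and c: "c \<in> carrier R" and closed: "\<And>t. t \<in> H \<Longrightarrow> t \<oplus> c \<in> H"
  shows "c = \<zero>"
proof -
  interpret U: group "units_of R" by (rule units_group)
  have HU: "H \<subseteq> Units R"
    using subgroup.subset[OF H] by (simp add: units_of_carrier)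
  then have HR: "H \<subseteq> carrier R"
    by (auto intro: Units_closed)
  have finH: "finite H"
    using HR fin by (rule finite_subset)
  have inj: "inj_on (\<lambda>t. t \<oplus> c) H"
    using HR c by (simp add: inj_on_def subset_iff)
  have img: "(\<lambda>t. t \<oplus> c) ` H = H"
    using finH inj closed by (intro endo_inj_surj) auto
  have sumR: "(\<Oplus>t\<in>H. t) \<in> carrier R"
    using HR by (auto intro!: finsum_closed)
  have "(\<Oplus>t\<in>H. t) = (\<Oplus>t\<in>(\<lambda>t. t \<oplus> c) ` H. t)"
    by (simp add: img)
  also have "\<dots> = (\<Oplus>t\<in>H. t \<oplus> c)"
    using inj HR c by (intro finsum_reindex) auto
  also have "\<dots> = (\<Oplus>t\<in>H. t) \<oplus> (\<Oplus>t\<in>H. c)"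
    using HR c by (intro finsum_addf) auto
  also have "(\<Oplus>t\<in>H. c) = [card H] \<cdot> c"
    using c by (rule add.finprod_const)
  finally have Hc: "[card H] \<cdot> c = \<zero>"
    using sumR c by simp
  have "card H dvd order (units_of R)"
    using U.lagrange[OF H] by (metis dvd_triv_right)
  also have "order (units_of R) = card (carrier R) - 1"
    using fin by (simp add: order_def units_of_carrier field_Units)
  finally obtain d where "card (carrier R) - 1 = card H * d"
    by blast
  moreover have "card (carrier R) > 0"
    using fin by (auto simp: card_gt_0_iff)
  ultimately have "card (carrier R) = Suc (card H * d)"
    by simp
  moreover have "[card (carrier R)] \<cdot> c = \<zero>"
    using add.pow_order_eq_1[of c] c by (simp add: order_def)
  ultimately have "\<zero> = [d] \<cdot> ([card H] \<cdot> c) \<oplus> c"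
    using c by (simp add: add.nat_pow_pow)
  then show ?thesis
    using c by (simp add: Hc)
qed

context finite_cring
begin

text \<open>
  An element that is not nilpotent survives in the residue field of some maximal ideal, where the
  image of \<open>H\<close> is again a group of units with the same translation symmetry.
\<close>

lemma units_subgroup_translation_nilpotent:
  assumes H: "subgroup H (units_of R)"
    and c: "c \<in> carrier R" and closed: "\<And>t. t \<in> H \<Longrightarrow> t \<oplus> c \<in> H"
  shows "c \<in> nilradical R"
proof (rule ccontr)
  assume "c \<notin> nilradical R"
  with c obtain M where M: "maximalideal M R" "c \<notin> M"
    by (auto simp: nilradical_eq_Inter_maximalideals)
  interpret M: maximalideal M R by fact
  interpret F: field "R Quot M"
    by (rule M.quotient_is_field[OF is_cring])
  interpret h: ring_hom_ring R "R Quot M" "(+>) M"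
    by (rule M.rcos_ring_hom_ring)
  interpret g: group_hom "units_of R" "units_of (R Quot M)" "(+>) M"
  proof (intro group_hom.intro group_hom_axioms.intro)
    show "group (units_of R)" "group (units_of (R Quot M))"
      by (rule units_group F.units_group)+
    show "(+>) M \<in> hom (units_of R) (units_of (R Quot M))"
    proof (rule homI)
      show "M +> u \<in> carrier (units_of (R Quot M))" if "u \<in> carrier (units_of R)" for u
        using that h.hom_Units unfolding units_of_carrier by blast
      show "M +> (u \<otimes>\<^bsub>units_of R\<^esub> v) = (M +> u) \<otimes>\<^bsub>units_of (R Quot M)\<^esub> (M +> v)"
        if "u \<in> carrier (units_of R)" "v \<in> carrier (units_of R)" for u v
        using that h.hom_mult[of u v] unfolding units_of_carrier units_of_mult
        by (simp only: Units_closed)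
    qed
  qed
  have "finite (carrier (R Quot M))"
    using finite_carrier by (simp only: carrier_FactRing finite_imageI)
  moreover have "subgroup ((+>) M ` H) (units_of (R Quot M))"
    by (rule g.subgroup_img_is_subgroup[OF H])
  moreover have "t \<oplus>\<^bsub>R Quot M\<^esub> (M +> c) \<in> (+>) M ` H" if t: "t \<in> (+>) M ` H" for t
  proof -
    obtain s where s: "s \<in> H" "t = M +> s"
      using t by blast
    moreover have "s \<in> carrier R"
      using s(1) subgroup.subset[OF H] by (auto simp: units_of_carrier)
    ultimately have "t \<oplus>\<^bsub>R Quot M\<^esub> (M +> c) = M +> (s \<oplus> c)"
      using c by (simp only: h.hom_add)
    then show ?thesis
      using closed[OF s(1)] by blast
  qed
  ultimately have "M +> c = \<zero>\<^bsub>R Quot M\<^esub>"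
    by (rule F.units_subgroup_translation_trivial[OF _ _ h.hom_closed[OF c]])
  then have "c \<in> M"
    using M.a_rcos_self[OF c] by (simp only: zero_FactRing)
  with M(2) show False
    by contradiction
qed

lemma unit_powers_subset_Units: "unit_powers R k \<subseteq> Units R"
  by (auto simp: unit_powers_def Units_pow_closed)

lemma unit_powers_mult_closed:
  "\<lbrakk>s \<in> unit_powers R k; t \<in> unit_powers R k\<rbrakk> \<Longrightarrow> s \<otimes> t \<in> unit_powers R k"
  unfolding unit_powers_def by (auto simp: nat_pow_distrib[symmetric] Units_closed)

lemma unit_powers_inv_closed:
  assumes "t \<in> unit_powers R k"
  shows "inv t \<in> unit_powers R k"
proof -
  obtain x where x: "x \<in> Units R" "t = x [^] k"
    using assms by (auto simp: unit_powers_def)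
  then have "(inv x) [^] k \<otimes> t = \<one>" "t \<otimes> (inv x) [^] k = \<one>"
    by (simp_all add: nat_pow_distrib[symmetric] Units_closed)
  with x have "inv t = (inv x) [^] k"
    by (metis Units_closed Units_inv_closed inv_unique' nat_pow_closed)
  with x show ?thesis
    by (auto simp: unit_powers_def)
qed

text \<open>
  This set is the neighbourhood of \<open>0\<close> in the graph. In the directed case the signs are essential:
  neighbours are then the ends of arcs in either direction.
\<close>

lemma signed_unit_powers_subgroup:
  "subgroup {t \<in> Units R. t \<in> unit_powers R k \<or> \<ominus> t \<in> unit_powers R k} (units_of R)"
  (is "subgroup ?T _")
proof -
  interpret U: group "units_of R" by (rule units_group)
  show ?thesis
  proof (rule U.subgroupI)
    show "?T \<subseteq> carrier (units_of R)"
      by (auto simp: units_of_carrier)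
    have "\<one> [^] k \<in> unit_powers R k"
      unfolding unit_powers_def by blast
    then show "?T \<noteq> {}"
      by auto
  next
    fix t assume t: "t \<in> ?T"
    then have "inv (\<ominus> t) = \<ominus> (inv t)"
      by (intro inv_unique'[symmetric]) (auto simp: l_minus r_minus Units_closed)
    with t show "inv\<^bsub>units_of R\<^esub> t \<in> ?T"
      using unit_powers_inv_closed[of t k] unit_powers_inv_closed[of "\<ominus> t" k]
      by (auto simp: units_of_inv)
  next
    fix s t assume st: "s \<in> ?T" "t \<in> ?T"
    then have "(\<ominus> s) \<otimes> t = \<ominus> (s \<otimes> t)" "s \<otimes> (\<ominus> t) = \<ominus> (s \<otimes> t)" "(\<ominus> s) \<otimes> (\<ominus> t) = s \<otimes> t"
      by (auto simp: l_minus r_minus Units_closed)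
    with st show "s \<otimes>\<^bsub>units_of R\<^esub> t \<in> ?T"
      using unit_powers_mult_closed[of s k t] unit_powers_mult_closed[of "\<ominus> s" k t]
        unit_powers_mult_closed[of s k "\<ominus> t"] unit_powers_mult_closed[of "\<ominus> s" k "\<ominus> t"]
      by (auto simp: units_of_mult)
  qed
qed

end

section \<open>Neighbourhoods in the Cayley graph\<close>

lemma (in ring) verts_unitary_cayley: "pverts (unitary_cayley R k) = carrier R"
  by (simp add: unitary_cayley_def cayley_digraph_def)

lemma (in ring) arcs_unitary_cayley:
  "(v, w) \<in> parcs (unitary_cayley R k) \<longleftrightarrow>
     v \<in> carrier R \<and> w \<in> carrier R \<and> w \<ominus> v \<in> unit_powers R k"
  by (simp add: unitary_cayley_def cayley_digraph_def a_minus_def a_inv_def)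

text \<open>
  In a symmetric graph every in-neighbour is an out-neighbour, so the two cases of the definition
  of \<open>nbrs\<close> have a common form.
\<close>

lemma nbrs_eq_in_or_out:
  "nbrs G a = {v \<in> pverts G. (a, v) \<in> parcs G \<or> (v, a) \<in> parcs G}"
  by (auto simp: nbrs_def symmetric_def dest: symD)

context finite_cring
begin

lemma nbrs_unitary_cayley:
  assumes "a \<in> carrier R"
  shows "nbrs (unitary_cayley R k) a =
    {v \<in> carrier R. v \<ominus> a \<in> unit_powers R k \<or> a \<ominus> v \<in> unit_powers R k}"
  using assms by (auto simp: nbrs_eq_in_or_out verts_unitary_cayley arcs_unitary_cayley)

lemma minus_mem_unit_powers_cong:
  fixes k :: nat
  assumes k: "k > 0" "coprime k (card (carrier R))"
    and carr: "a \<in> carrier R" "b \<in> carrier R" "a' \<in> carrier R" "b' \<in> carrier R"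
    and cong: "a \<ominus> a' \<in> nilradical R" "b \<ominus> b' \<in> nilradical R"
    and mem: "b \<ominus> a \<in> unit_powers R k"
  shows "b' \<ominus> a' \<in> unit_powers R k"
proof -
  interpret N: ideal "nilradical R" R by (rule nilradical_ideal)
  have "(a \<ominus> a') \<oplus> \<ominus> (b \<ominus> b') \<in> nilradical R"
    using cong by (intro N.a_closed N.a_inv_closed)
  then have "(b \<ominus> a) \<oplus> ((a \<ominus> a') \<oplus> \<ominus> (b \<ominus> b')) \<in> unit_powers R k"
    by (rule unit_powers_closed_add_nilpotent[OF k mem])
  moreover have "(b \<ominus> a) \<oplus> ((a \<ominus> a') \<oplus> \<ominus> (b \<ominus> b')) = b' \<ominus> a'"
    using carr by algebra
  ultimately show ?thesis
    by metis
qed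

text \<open>
  Shifting by \<open>a\<close> turns equality of the neighbourhoods \<open>a + T\<close> and \<open>b + T\<close>, with \<open>T = U \<union> -U\<close>,
  into the symmetry of \<open>T\<close> under translation by \<open>a - b\<close>. The converse is the absorption of
  nilpotent elements by \<open>U\<close>.
\<close>

lemma nbrs_unitary_cayley_eq_iff:
  fixes k :: nat
  assumes k: "k > 0" "coprime k (card (carrier R))"
    and a: "a \<in> carrier R" and b: "b \<in> carrier R"
  shows "nbrs (unitary_cayley R k) a = nbrs (unitary_cayley R k) b \<longleftrightarrow> a \<ominus> b \<in> nilradical R"
proof
  assume eq: "nbrs (unitary_cayley R k) a = nbrs (unitary_cayley R k) b"
  let ?T = "{t \<in> Units R. t \<in> unit_powers R k \<or> \<ominus> t \<in> unit_powers R k}"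
  show "a \<ominus> b \<in> nilradical R"
  proof (rule units_subgroup_translation_nilpotent[OF signed_unit_powers_subgroup[of k]])
    show "a \<ominus> b \<in> carrier R"
      using a b by simp
    fix t assume t: "t \<in> ?T"
    then have tR: "t \<in> carrier R"
      by auto
    have 1: "(t \<oplus> a) \<ominus> a = t" "a \<ominus> (t \<oplus> a) = \<ominus> t"
      using tR a by algebra+
    have 2: "(t \<oplus> a) \<ominus> b = t \<oplus> (a \<ominus> b)" "b \<ominus> (t \<oplus> a) = \<ominus> (t \<oplus> (a \<ominus> b))"
      using tR a b by algebra+
    have "t \<oplus> a \<in> nbrs (unitary_cayley R k) a"
      using t tR a by (simp add: nbrs_unitary_cayley 1)
    then have "t \<oplus> a \<in> nbrs (unitary_cayley R k) b"
      by (simp only: eq)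
    then have mem: "t \<oplus> (a \<ominus> b) \<in> unit_powers R k \<or> \<ominus> (t \<oplus> (a \<ominus> b)) \<in> unit_powers R k"
      unfolding nbrs_unitary_cayley[OF b] mem_Collect_eq 2 by blast
    moreover have "t \<oplus> (a \<ominus> b) \<in> Units R"
    proof -
      have "\<ominus> (\<ominus> (t \<oplus> (a \<ominus> b))) = t \<oplus> (a \<ominus> b)"
        using tR a b by (intro minus_minus) simp
      with mem show ?thesis
        using unit_powers_subset_Units[of k] by (metis Units_a_inv_closed subsetD)
    qed
    ultimately show "t \<oplus> (a \<ominus> b) \<in> ?T"
      by blast
  qed
next
  interpret N: ideal "nilradical R" R by (rule nilradical_ideal)
  assume ab: "a \<ominus> b \<in> nilradical R"
  have "\<ominus> (a \<ominus> b) = b \<ominus> a"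
    using a b by algebra
  then have ba: "b \<ominus> a \<in> nilradical R"
    using N.a_inv_closed[OF ab] by simp
  have refl: "v \<ominus> v \<in> nilradical R" if "v \<in> carrier R" for v
    using that N.zero_closed by (simp add: a_minus_def r_neg)
  show "nbrs (unitary_cayley R k) a = nbrs (unitary_cayley R k) b"
    unfolding nbrs_unitary_cayley[OF a] nbrs_unitary_cayley[OF b]
    using minus_mem_unit_powers_cong[OF k] a b ab ba refl by blast
qed

lemma nbr_class_unitary_cayley:
  fixes k :: nat
  assumes k: "k > 0" "coprime k (card (carrier R))" and a: "a \<in> carrier R"
  shows "nbr_class (unitary_cayley R k) a = nilradical R +> a"
proof -
  interpret N: ideal "nilradical R" R by (rule nilradical_ideal)
  have "b \<in> nilradical R +> a \<longleftrightarrow> b \<in> carrier R \<and> b \<ominus> a \<in> nilradical R" for b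
    using N.a_rcos_module_minus[OF ring_axioms a] N.a_elemrcos_carrier[OF a] by blast
  moreover have "nbrs (unitary_cayley R k) a = nbrs (unitary_cayley R k) b \<longleftrightarrow> b \<ominus> a \<in> nilradical R"
    if "b \<in> carrier R" for b
    using nbrs_unitary_cayley_eq_iff[OF k that a] by metis
  ultimately show ?thesis
    by (auto simp: nbr_class_def verts_unitary_cayley)
qed

section \<open>The reduced graph\<close>

text \<open>
  A coset that is a unit of \<open>R / N\<close> consists of units of \<open>R\<close>: if \<open>y x = 1 + n\<close> with \<open>n\<close> nilpotent,
  then \<open>y x\<close> is a unit, hence so is \<open>x\<close>. If therefore the coset of \<open>a\<close> is a \<open>k\<close>-th power of a
  unit, then \<open>a\<close> differs by a nilpotent element from some \<open>x\<^sup>k\<close> with \<open>x\<close> a unit, and \<open>U + N = U\<close>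
  applies.
\<close>

lemma coset_mem_unit_powers_iff:
  fixes k :: nat
  assumes k: "k > 0" "coprime k (card (carrier R))" and a: "a \<in> carrier R"
  shows "nilradical R +> a \<in> unit_powers (reduced_ring R) k \<longleftrightarrow> a \<in> unit_powers R k"
proof -
  interpret N: ideal "nilradical R" R by (rule nilradical_ideal)
  interpret Q: cring "reduced_ring R"
    unfolding reduced_ring_def by (rule N.quotient_is_cring[OF is_cring])
  interpret h: ring_hom_ring R "reduced_ring R" "(+>) (nilradical R)"
    unfolding reduced_ring_def by (rule N.rcos_ring_hom_ring)
  have coset_eq: "nilradical R +> x = nilradical R +> y \<longleftrightarrow> x \<ominus> y \<in> nilradical R"
    if "x \<in> carrier R" "y \<in> carrier R" for x y
    using quotient_eq_iff_same_a_r_cos[OF N.is_ideal that] by blast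
  have carrQ: "carrier (reduced_ring R) = (+>) (nilradical R) ` carrier R"
    by (simp only: reduced_ring_def carrier_FactRing)
  have unit_iff: "nilradical R +> x \<in> Units (reduced_ring R) \<longleftrightarrow> x \<in> Units R"
    if x: "x \<in> carrier R" for x
  proof
    assume "x \<in> Units R"
    then show "nilradical R +> x \<in> Units (reduced_ring R)"
      by (rule h.hom_Units)
  next
    assume "nilradical R +> x \<in> Units (reduced_ring R)"
    then obtain y where y: "y \<in> carrier R"
      "(nilradical R +> y) \<otimes>\<^bsub>reduced_ring R\<^esub> (nilradical R +> x) = \<one>\<^bsub>reduced_ring R\<^esub>"
      unfolding Units_def carrQ by blast
    then have "nilradical R +> (y \<otimes> x) = nilradical R +> \<one>"
      using x h.hom_mult[of y x] h.hom_one by simp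
    then have "y \<otimes> x \<ominus> \<one> \<in> nilradical R"
      using coset_eq[of "y \<otimes> x" \<one>] m_closed[OF y(1) x] by blast
    then have "\<one> \<oplus> (y \<otimes> x \<ominus> \<one>) \<in> Units R"
      by (intro Units_add_nilpotent) auto
    moreover have "\<one> \<oplus> (y \<otimes> x \<ominus> \<one>) = y \<otimes> x"
      using x y(1) by algebra
    ultimately have "y \<otimes> x \<in> Units R"
      by metis
    then show "x \<in> Units R"
      unfolding m_comm[OF y(1) x] by (rule unit_factor[OF _ x y(1)])
  qed
  have pow: "(nilradical R +> x) [^]\<^bsub>reduced_ring R\<^esub> k = nilradical R +> (x [^] k)" if "x \<in> carrier R" for x
    using h.hom_nat_pow[OF that] by simp
  show ?thesis
  proof
    assume "a \<in> unit_powers R k"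
    then obtain x where "x \<in> Units R" "a = x [^] k"
      by (auto simp: unit_powers_def)
    then show "nilradical R +> a \<in> unit_powers (reduced_ring R) k"
      unfolding unit_powers_def using pow[of x] unit_iff[of x] Units_closed[of x] by force
  next
    assume "nilradical R +> a \<in> unit_powers (reduced_ring R) k"
    then obtain X where X: "X \<in> Units (reduced_ring R)" "nilradical R +> a = X [^]\<^bsub>reduced_ring R\<^esub> k"
      by (auto simp: unit_powers_def)
    moreover obtain x where x: "x \<in> carrier R" "X = nilradical R +> x"
      using Q.Units_closed[OF X(1)] unfolding carrQ by blast
    ultimately have "x \<in> Units R" and "nilradical R +> a = nilradical R +> (x [^] k)"
      by (simp_all add: unit_iff pow)
    then have "x [^] k \<in> unit_powers R k" "a \<ominus> x [^] k \<in> nilradical R"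
      using a x(1) by (auto simp: unit_powers_def coset_eq)
    then have "x [^] k \<oplus> (a \<ominus> x [^] k) \<in> unit_powers R k"
      by (rule unit_powers_closed_add_nilpotent[OF k])
    moreover have "x [^] k \<oplus> (a \<ominus> x [^] k) = a"
      using a x(1) nat_pow_closed[OF x(1), of k] by algebra
    ultimately show "a \<in> unit_powers R k"
      by metis
  qed
qed

lemma arcs_unitary_cayley_reduced_ring_iff:
  fixes k :: nat
  assumes k: "k > 0" "coprime k (card (carrier R))" and a: "a \<in> carrier R" and b: "b \<in> carrier R"
  shows "(nilradical R +> a, nilradical R +> b) \<in> parcs (unitary_cayley (reduced_ring R) k) \<longleftrightarrow>
    (a, b) \<in> parcs (unitary_cayley R k)"
proof -
  interpret N: ideal "nilradical R" R by (rule nilradical_ideal)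
  interpret h: ring_hom_ring R "reduced_ring R" "(+>) (nilradical R)"
    unfolding reduced_ring_def by (rule N.rcos_ring_hom_ring)
  have "(nilradical R +> b) \<ominus>\<^bsub>reduced_ring R\<^esub> (nilradical R +> a) = nilradical R +> (b \<ominus> a)"
    using a b by (simp add: a_minus_def)
  then show ?thesis
    using a b coset_mem_unit_powers_iff[OF k, of "b \<ominus> a"]
    by (simp add: arcs_unitary_cayley h.S.arcs_unitary_cayley)
qed

text \<open>
  No renaming of vertices is involved: the class of \<open>a\<close> and the coset \<open>a + N\<close> are the same set.
\<close>

theorem reduced_graph_unitary_cayley:
  fixes k :: nat
  assumes k: "k > 0" "coprime k (card (carrier R))"
  shows "reduced_graph (unitary_cayley R k) = unitary_cayley (reduced_ring R) k"
proof (rule pair_pre_digraph.equality)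
  interpret N: ideal "nilradical R" R by (rule nilradical_ideal)
  interpret Q: ring "reduced_ring R"
    unfolding reduced_ring_def by (rule N.quotient_is_ring)
  note cls = nbr_class_unitary_cayley[OF k]
  have carrQ: "carrier (reduced_ring R) = (+>) (nilradical R) ` carrier R"
    by (simp only: reduced_ring_def carrier_FactRing)
  show "pverts (reduced_graph (unitary_cayley R k)) = pverts (unitary_cayley (reduced_ring R) k)"
    by (simp add: reduced_graph_def verts_unitary_cayley Q.verts_unitary_cayley carrQ cls cong: image_cong)
  show "parcs (reduced_graph (unitary_cayley R k)) = parcs (unitary_cayley (reduced_ring R) k)"
  proof (intro equalityI subrelI)
    fix A B assume "(A, B) \<in> parcs (reduced_graph (unitary_cayley R k))"
    then obtain a b where ab: "(a, b) \<in> parcs (unitary_cayley R k)"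
      and "A = nbr_class (unitary_cayley R k) a" "B = nbr_class (unitary_cayley R k) b"
      by (auto simp: reduced_graph_def)
    moreover have "a \<in> carrier R" "b \<in> carrier R"
      using ab by (simp_all add: arcs_unitary_cayley)
    ultimately show "(A, B) \<in> parcs (unitary_cayley (reduced_ring R) k)"
      by (simp add: cls arcs_unitary_cayley_reduced_ring_iff[OF k])
  next
    fix A B assume AB: "(A, B) \<in> parcs (unitary_cayley (reduced_ring R) k)"
    then obtain a b where "a \<in> carrier R" "b \<in> carrier R" "A = nilradical R +> a" "B = nilradical R +> b"
      unfolding Q.arcs_unitary_cayley carrQ by blast
    with AB show "(A, B) \<in> parcs (reduced_graph (unitary_cayley R k))"
      using arcs_unitary_cayley_reduced_ring_iff[OF k] cls
      unfolding reduced_graph_def by force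
  qed
qed simp

end

lemma digraph_iso_refl:
  assumes "wf_digraph G"
  shows "digraph_iso G G"
  unfolding digraph_iso_def
proof (intro exI conjI)
  let ?id = "\<lparr>iso_verts = id, iso_arcs = id, iso_head = head G, iso_tail = tail G\<rparr>"
  show "pre_digraph.digraph_isomorphism G ?id"
    using assms by (simp add: pre_digraph.digraph_isomorphism_def)
  show "G = app_iso ?id G"
    by (simp add: app_iso_def)
qed

theorem theorem6p6:
  fixes R :: "('a, 'b) ring_scheme" and k :: nat
  assumes "cring R" and "finite (carrier R)"
    and "k > 0"
    and "gcd k (card (carrier R)) = 1"
  shows "reduced_graph_well_defined (unitary_cayley R k) \<and>
    digraph_iso (with_proj (reduced_graph (unitary_cayley R k)))
                (with_proj (unitary_cayley (reduced_ring R) k))"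
proof
  interpret finite_cring R
    using assms(1,2) by (simp add: finite_cring_def finite_cring_axioms_def)
  interpret N: ideal "nilradical R" R by (rule nilradical_ideal)
  interpret Q: ring "reduced_ring R"
    unfolding reduced_ring_def by (rule N.quotient_is_ring)
  have k: "k > 0" "coprime k (card (carrier R))"
    using assms(3,4) by (simp_all add: coprime_iff_gcd_eq_1)
  note red = reduced_graph_unitary_cayley[OF k]
  show "reduced_graph_well_defined (unitary_cayley R k)"
    unfolding reduced_graph_well_defined_def red
    by (simp add: verts_unitary_cayley nbr_class_unitary_cayley[OF k]
          arcs_unitary_cayley_reduced_ring_iff[OF k])
  have "wf_digraph (with_proj (unitary_cayley (reduced_ring R) k))"
    by standard (auto simp: Q.arcs_unitary_cayley Q.verts_unitary_cayley)
  then show "digraph_iso (with_proj (reduced_graph (unitary_cayley R k)))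
      (with_proj (unitary_cayley (reduced_ring R) k))"
    unfolding red by (rule digraph_iso_refl)
qed

end
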